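(* Let $m\in\mathbb Z$ be fixed. Then for every $a\in C([0,\pi])$ $$\frac{2l+1}{2}\,\frac{(l-m)!}{(l+m)!}\int_0^\pi a(\theta)\,\sin(\theta)\,|P_{l,m}(\cos\theta)|^2\,d\theta\ \longrightarrow\ \frac1\pi\int_0^\pi a(\theta)\,d\theta\qquad\text{as }l\to\infty,$$ where $l$ runs through all integers $l\ge|m|$.
   Context: For integers $l\ge|m|$, $P_{l,m}$ denotes the associated Legendre polynomial $$P_{l,m}(x)=\frac{(-1)^m}{2^l\,l!}(1-x^2)^{m/2}\frac{d^{l+m}}{dx^{l+m}}(x^2-1)^l .$$ *)

theory Defs
  imports "HOL-Analysis.Analysis"
begin

text \<open>
  The associated Legendre function for integers \<open>l \<ge> \<bar>m\<bar>\<close> (only then are the values meaningful;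
  \<open>nat (int l + m)\<close> truncates otherwise).
  The factor \<open>(1 - x^2)^(m/2)\<close> is written as an integer power of \<open>sqrt (1 - x\<^sup>2)\<close>, for \<open>-1 \<le> x \<le> 1\<close>,
  rather than with \<open>powr\<close>, because \<open>0 powr 0 = 0\<close> would give a wrong value at \<open>x = \<plusminus>1\<close>
  when \<open>m = 0\<close>. For \<open>m < 0\<close> the convention \<open>inverse 0 = 0\<close> gives the value \<open>0\<close> at \<open>x = \<plusminus>1\<close>,
  which is the continuous extension from the open interval.
\<close>

definition assoc_Legendre :: "nat \<Rightarrow> int \<Rightarrow> real \<Rightarrow> real" where
  "assoc_Legendre l m x =
     (-1) powi m / (2 ^ l * fact l) * sqrt (1 - x\<^sup>2) powi m *
     (deriv ^^ nat (int l + m)) (\<lambda>t. (t\<^sup>2 - 1) ^ l) x"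

end

theory Submission
  imports Defs
begin

text \<open>
  The normalised weights \<open>w\<^sub>l(\<theta>) = (2l+1)/2 \<cdot> (l-m)!/(l+m)! \<cdot> sin \<theta> P\<^sub>l\<^sub>,\<^sub>m(cos \<theta>)\<^sup>2\<close> are probability
  densities on \<open>[0, \<pi>]\<close>, and the claim is their weak convergence to the uniform density. By the
  Weierstrass theorem in the variable \<open>x = cos \<theta>\<close> it suffices that every moment of \<open>cos \<theta>\<close>
  converges (\<open>weak_convergence_from_cos_moments\<close>).

  For the moments the idea is to look at multiplication by \<open>x\<close> in the basis of normalised associated
  Legendre functions of order \<open>m\<close>. There it is a Jacobi matrix, by the three-term recurrence, whose
  off-diagonal entries tend to \<open>1/2\<close>. Far out in the basis it thus looks like half the sum of the
  two unit shifts, and this is how multiplication by \<open>cos \<theta>\<close> acts on the functions \<open>cos(j\<theta>)\<close>. So the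
  matrix element of \<open>x\<^sup>k\<close> between degrees \<open>l\<close> and \<open>l + j\<close> tends to
  \<open>(1/\<pi>) \<integral> cos(j\<theta>) cos\<^sup>k \<theta> d\<theta>\<close>, by induction on \<open>k\<close> (\<open>cross_moment_tendsto\<close>); the
  diagonal case \<open>j = 0\<close> is the required moment. The induction starts from orthogonality.

  Both the recurrence and orthogonality come from Rodrigues' formula. With
  \<open>p\<^sub>l = (x\<^sup>2 - 1)\<^sup>l / (2\<^sup>l l!)\<close>, the recurrence is a consequence of \<open>p'\<^sub>l\<^sub>+\<^sub>1 = x p\<^sub>l\<close>
  (\<open>rodrigues_deriv_recurrence\<close>). The reflection formula \<open>rodrigues_deriv_reflect\<close> between the orders
  \<open>m\<close> and \<open>-m\<close> shows that \<open>(l-m)!/(l+m)! P\<^sub>l\<^sub>,\<^sub>m\<^sup>2\<close> is, up to sign, the product of the derivatives of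
  \<open>p\<^sub>l\<close> of orders \<open>l + m\<close> and \<open>l - m\<close>, for either sign of \<open>m\<close>. All integrals then concern polynomials,
  and integration by parts yields orthogonality and reduces the norm to the case \<open>m = 0\<close>.
\<close>

section \<open>Derivatives of the Rodrigues polynomials\<close>

text \<open>
  The polynomials \<open>p\<^sub>l = (x\<^sup>2 - 1)\<^sup>l / (2\<^sup>l l!)\<close> of Rodrigues' formula. Their normalisation makes
  \<open>p'\<^sub>l\<^sub>+\<^sub>1 = x p\<^sub>l\<close> free of constants, and \<open>rodrigues_deriv l l\<close> is the Legendre polynomial of degree \<open>l\<close>.
\<close>

definition rodrigues :: "nat \<Rightarrow> real poly" where
  "rodrigues l = smult (1 / (2 ^ l * fact l)) ([:-1, 0, 1:] ^ l)"

abbreviation rodrigues_deriv :: "nat \<Rightarrow> nat \<Rightarrow> real poly" where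
  "rodrigues_deriv n l \<equiv> (pderiv ^^ n) (rodrigues l)"

lemma real_poly_eqI: "(\<And>x. poly p x = poly q x) \<Longrightarrow> p = q" for p q :: "real poly"
  using poly_eq_poly_eq_iff[of p q] by auto

lemma rodrigues_0 [simp]: "rodrigues 0 = 1"
  by (simp add: rodrigues_def)

lemma rodrigues_Suc: "[:-1, 0, 1:] * rodrigues l = smult (2 * (real l + 1)) (rodrigues (Suc l))"
proof -
  have "2 * (real l + 1) * (1 / (2 ^ Suc l * fact (Suc l))) = 1 / (2 ^ l * fact l)"
    by (simp add: divide_simps)
  then show ?thesis
    unfolding rodrigues_def smult_smult by (simp only:) simp
qed

lemma pderiv_rodrigues_Suc: "pderiv (rodrigues (Suc l)) = [:0, 1:] * rodrigues l"
proof -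
  have "pderiv [:-1, 0, 1 :: real:] = smult 2 [:0, 1:]"
    by (simp add: pderiv_pCons)
  moreover have "1 / (2 ^ Suc l * fact (Suc l)) * (real (Suc l) * 2) = 1 / (2 ^ l * fact l)"
    by (simp add: divide_simps)
  ultimately show ?thesis
    by (simp add: rodrigues_def pderiv_smult pderiv_power_Suc mult.commute del: power_Suc fact_Suc)
qed

text \<open>
  Differentiating \<open>p'\<^sub>l\<^sub>+\<^sub>2 = x p\<^sub>l\<^sub>+\<^sub>1\<close> once more gives \<open>p\<^sub>l\<^sub>+\<^sub>1 + x\<^sup>2 p\<^sub>l\<close>; writing \<open>x\<^sup>2\<close> as \<open>(x\<^sup>2 - 1) + 1\<close> turns
  this into a combination of the \<open>p\<close>'s alone.
\<close>

lemma pderiv2_rodrigues: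
  "pderiv (pderiv (rodrigues (l + 2))) = smult (2 * real l + 3) (rodrigues (l + 1)) + rodrigues l"
proof -
  have "pderiv (pderiv (rodrigues (l + 2))) = rodrigues (l + 1) + [:0, 1:] * ([:0, 1:] * rodrigues l)"
    by (simp add: pderiv_rodrigues_Suc pderiv_mult pderiv_pCons algebra_simps flip: One_nat_def)
       (simp add: pderiv_rodrigues_Suc)
  also have "\<dots> = rodrigues (l + 1) + [:-1, 0, 1:] * rodrigues l + rodrigues l"
    by (rule real_poly_eqI) (simp add: algebra_simps)
  finally show ?thesis
    by (subst (asm) rodrigues_Suc, intro real_poly_eqI) (simp add: algebra_simps)
qed

lemma higher_pderiv_X_mult:
  "(pderiv ^^ n) ([:0, 1:] * q) = [:0, 1:] * (pderiv ^^ n) q + smult (real n) ((pderiv ^^ (n - 1)) q)"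
proof (induction n)
  case (Suc n)
  then show ?case
    by (cases n; intro real_poly_eqI)
       (simp_all add: pderiv_add pderiv_smult pderiv_mult pderiv_pCons algebra_simps)
qed simp

text \<open>
  This is the three-term recurrence of the associated Legendre functions in the degree, at fixed
  order \<open>m\<close>, with \<open>n = l + 1 + m\<close>. There are two ways to differentiate \<open>p\<^sub>l\<^sub>+\<^sub>2\<close> \<open>n + 1\<close> times: through
  \<open>p'\<^sub>l\<^sub>+\<^sub>2 = x p\<^sub>l\<^sub>+\<^sub>1\<close> and the Leibniz rule, or through \<open>pderiv2_rodrigues\<close>. Both involve the derivative of
  \<open>p\<^sub>l\<^sub>+\<^sub>1\<close> of order \<open>n - 1\<close>, and eliminating it leaves the recurrence. For \<open>n = 0\<close> the truncated
  \<open>n - 1\<close> is harmless because its term has the coefficient \<open>0\<close>.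
\<close>

lemma rodrigues_deriv_recurrence:
  "smult (2 * real l + 3 - real n) (rodrigues_deriv (n + 1) (l + 2)) =
   smult (2 * real l + 3) ([:0, 1:] * rodrigues_deriv n (l + 1)) - smult (real n) (rodrigues_deriv (n - 1) l)"
proof (cases n)
  case 0
  then show ?thesis
    using pderiv_rodrigues_Suc[of "l + 1"] by simp
next
  case (Suc k)
  have a: "rodrigues_deriv (n + 1) (l + 2) =
      [:0, 1:] * rodrigues_deriv n (l + 1) + smult (real n) (rodrigues_deriv k (l + 1))"
    using higher_pderiv_X_mult[of n "rodrigues (l + 1)"] pderiv_rodrigues_Suc[of "l + 1"] Suc
    by (simp del: funpow.simps add: funpow_Suc_right)
  have b: "rodrigues_deriv (n + 1) (l + 2) =
      smult (2 * real l + 3) (rodrigues_deriv k (l + 1)) + rodrigues_deriv k l"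
    using pderiv2_rodrigues[of l] Suc
    by (simp del: funpow.simps add: funpow_Suc_right higher_pderiv_add higher_pderiv_smult)
  show ?thesis
  proof (rule real_poly_eqI)
    fix x
    have a': "poly (rodrigues_deriv (n + 1) (l + 2)) x =
      x * poly (rodrigues_deriv n (l + 1)) x + real n * poly (rodrigues_deriv k (l + 1)) x"
      by (subst a) simp
    have b': "poly (rodrigues_deriv (n + 1) (l + 2)) x =
      (2 * real l + 3) * poly (rodrigues_deriv k (l + 1)) x + poly (rodrigues_deriv k l) x"
      by (subst b) simp
    have "(2 * real l + 3 - real n) * poly (rodrigues_deriv (n + 1) (l + 2)) x =
       (2 * real l + 3) * (x * poly (rodrigues_deriv n (l + 1)) x) - real n * poly (rodrigues_deriv k l) x"
      using a' b' by algebra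
    then show "poly (smult (2 * real l + 3 - real n) (rodrigues_deriv (n + 1) (l + 2))) x =
       poly (smult (2 * real l + 3) ([:0, 1:] * rodrigues_deriv n (l + 1)) - smult (real n) (rodrigues_deriv (n - 1) l)) x"
      using Suc by simp
  qed
qed

lemma degree_rodrigues: "degree (rodrigues l) = 2 * l"
  by (simp add: rodrigues_def degree_power_eq)

lemma rodrigues_deriv_eq_0: "n > 2 * l \<Longrightarrow> rodrigues_deriv n l = 0"
proof -
  assume "n > 2 * l"
  then obtain k where k: "n = Suc (2 * l + k)"
    using less_imp_Suc_add by blast
  have "degree (rodrigues_deriv (2 * l + k) l) = 0"
    by (simp add: degree_higher_pderiv degree_rodrigues)
  then show ?thesis
    using k by (simp add: pderiv_eq_0_iff)
qed

text \<open>
  The derivative of order \<open>2l\<close> of \<open>p\<^sub>l\<close> is the constant \<open>(2l)! / (2\<^sup>l l!)\<close>. This is the reflection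
  formula below in the extreme case where the order equals the degree.
\<close>

lemma fact_mult_rodrigues: "smult (fact (2 * l)) (rodrigues l) = [:-1, 0, 1:] ^ l * rodrigues_deriv (2 * l) l"
proof -
  have "degree (rodrigues_deriv (2 * l) l) = 0"
    by (simp add: degree_higher_pderiv degree_rodrigues)
  moreover have "lead_coeff ([:-1, 0, 1:] ^ l :: real poly) = 1"
    by (simp only: lead_coeff_power) simp
  then have "coeff ([:-1, 0, 1:] ^ l :: real poly) (l * 2) = 1"
    by (simp add: degree_power_eq mult_2[symmetric] mult.commute[of l])
  then have "coeff (rodrigues l) (2 * l) = 1 / (2 ^ l * fact l)"
    by (simp add: rodrigues_def mult_2 mult_2_right)
  then have "coeff (rodrigues_deriv (2 * l) l) 0 = fact (2 * l) / (2 ^ l * fact l)"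
    by (simp add: coeff_higher_pderiv pochhammer_fact)
  ultimately have "rodrigues_deriv (2 * l) l = [:fact (2 * l) / (2 ^ l * fact l):]"
    by (metis coeff_pCons_0 degree_eq_zeroE)
  then show ?thesis
    by (simp add: rodrigues_def)
qed

text \<open>
  With \<open>l = \<mu> + k\<close> this reads
  \<open>(l + \<mu>)! D\<^bsup>l-\<mu>\<^esup> p\<^sub>l = (l - \<mu>)! (x\<^sup>2 - 1)\<^sup>\<mu> D\<^bsup>l+\<mu>\<^esup> p\<^sub>l\<close>, the proportionality of the associated Legendre
  functions of orders \<open>\<mu>\<close> and \<open>-\<mu>\<close>. Once the equation is divided by
  \<open>(l - \<mu>)! (l + \<mu>)!\<close>, both sides satisfy the same three-term recurrence in \<open>l\<close>, whose coefficients then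
  depend on \<open>\<mu>\<^sup>2\<close> only. So a two-step induction on \<open>k\<close> suffices.
\<close>

lemma rodrigues_deriv_reflect:
  "smult (fact (2 * \<mu> + k)) (rodrigues_deriv k (\<mu> + k)) =
   smult (fact k) ([:-1, 0, 1:] ^ \<mu> * rodrigues_deriv (2 * \<mu> + k) (\<mu> + k))"
proof (induction k rule: less_induct)
  case (less k)
  consider "k = 0" | "k = 1" "\<mu> = 0" | "k = 1" "\<mu> > 0" | j where "k = j + 2"
  proof -
    have "k = 0 \<or> k = 1 \<and> \<mu> = 0 \<or> k = 1 \<and> \<mu> > 0 \<or> k = (k - 2) + 2"
      by linarith
    then show thesis using that by blast
  qed
  then show ?case
  proof cases
    case 1
    then show ?thesis using fact_mult_rodrigues by simp
  next
    case 2
    then show ?thesis by simp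
  next
    case 3
    (* The last term of the recurrence vanishes for degree reasons, so it has only two terms here. *)
    obtain \<nu> where \<nu>: "\<mu> = Suc \<nu>" using 3(2) gr0_implies_Suc by blast
    have r: "rodrigues_deriv (2 * \<mu> + 1) (\<mu> + 1) = smult (2 * real \<mu> + 1) ([:0, 1:] * rodrigues_deriv (2 * \<mu>) \<mu>)"
      using rodrigues_deriv_recurrence[of \<nu> "2 * \<mu>"] rodrigues_deriv_eq_0[of \<nu> "2 * \<mu> - 1"]
      by (simp add: \<nu> algebra_simps)
    have "smult (fact (2 * \<mu> + 1)) (rodrigues_deriv 1 (\<mu> + 1)) =
        smult (2 * real \<mu> + 1) ([:0, 1:] * smult (fact (2 * \<mu>)) (rodrigues \<mu>))"
      using pderiv_rodrigues_Suc[of \<mu>] by (simp add: algebra_simps)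
    also have "\<dots> = [:-1, 0, 1:] ^ \<mu> * rodrigues_deriv (2 * \<mu> + 1) (\<mu> + 1)"
      by (subst r, subst fact_mult_rodrigues) (simp add: algebra_simps)
    finally show ?thesis using 3 by simp
  next
    case 4
    define Y :: "real poly" where "Y = [:-1, 0, 1:] ^ \<mu>"
    show ?thesis
    proof (rule real_poly_eqI)
      fix x
      define A where "A i = poly (rodrigues_deriv i (\<mu> + i)) x" for i
      define B where "B i = poly (rodrigues_deriv (2 * \<mu> + i) (\<mu> + i)) x" for i
      define y where "y = poly Y x"
      define F :: real where "F = fact (2 * \<mu> + j)"
      define G :: real where "G = fact j"
      have F: "fact (2 * \<mu> + j + 1) = (2 * real \<mu> + j + 1) * F"
        "fact (2 * \<mu> + j + 2) = (2 * real \<mu> + j + 2) * ((2 * real \<mu> + j + 1) * F)"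
        by (simp_all add: F_def algebra_simps)
      have G: "fact (j + 1) = (j + 1) * G" "fact (j + 2) = (real j + 2) * ((j + 1) * G)"
        by (simp_all add: G_def)
      have IH0: "F * A j = G * (y * B j)"
        using arg_cong[OF less.IH[of j], of "\<lambda>p. poly p x"] 4
        by (simp add: A_def B_def y_def F_def G_def Y_def)
      have IH1: "(2 * real \<mu> + j + 1) * F * A (j + 1) = (j + 1) * G * (y * B (j + 1))"
        using arg_cong[OF less.IH[of "j + 1"], of "\<lambda>p. poly p x"] 4 F(1) G(1)
        by (simp add: A_def B_def y_def F_def G_def Y_def add_ac)
      have rA: "(2 * real \<mu> + j + 2) * A (j + 2) =
          (2 * real \<mu> + 2 * j + 3) * x * A (j + 1) - (real j + 1) * A j"
        using arg_cong[OF rodrigues_deriv_recurrence[of "\<mu> + j" "j + 1"], of "\<lambda>p. poly p x"]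
        by (simp add: A_def algebra_simps)
      have rB: "(real j + 2) * B (j + 2) =
          (2 * real \<mu> + 2 * j + 3) * x * B (j + 1) - (2 * real \<mu> + real j + 1) * B j"
        using arg_cong[OF rodrigues_deriv_recurrence[of "\<mu> + j" "2 * \<mu> + j + 1"], of "\<lambda>p. poly p x"]
        by (simp add: B_def algebra_simps)
      have "(2 * real \<mu> + j + 2) * ((2 * real \<mu> + j + 1) * F) * A (j + 2) =
            (real j + 2) * ((j + 1) * G) * (y * B (j + 2))"
      proof -
        have "(2 * real \<mu> + j + 2) * ((2 * real \<mu> + j + 1) * F) * A (j + 2) =
            ((2 * real \<mu> + j + 1) * F) * ((2 * real \<mu> + j + 2) * A (j + 2))"
          by simp
        also have "\<dots> = (2 * real \<mu> + 2 * j + 3) * x * ((2 * real \<mu> + j + 1) * F * A (j + 1))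
            - (2 * real \<mu> + j + 1) * (real j + 1) * (F * A j)"
          unfolding rA by (simp add: algebra_simps)
        also have "\<dots> = (j + 1) * G * y * ((real j + 2) * B (j + 2))"
          unfolding rB IH0 IH1 by (simp add: algebra_simps)
        finally show ?thesis by simp
      qed
      then have "fact (2 * \<mu> + j + 2) * A (j + 2) = fact (j + 2) * (y * B (j + 2))"
        using F G by (simp add: add_ac)
      then show "poly (smult (fact (2 * \<mu> + k)) (rodrigues_deriv k (\<mu> + k))) x =
        poly (smult (fact k) ([:-1, 0, 1:] ^ \<mu> * rodrigues_deriv (2 * \<mu> + k) (\<mu> + k))) x"
        unfolding 4 by (simp only: A_def B_def y_def Y_def poly_smult poly_mult add.assoc)
    qed
  qed
qed

lemma power_dvd_pderiv:
  fixes q f :: "real poly"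
  assumes "q ^ Suc j dvd f"
  shows "q ^ j dvd pderiv f"
proof -
  obtain g where g: "f = q ^ Suc j * g"
    using assms by (rule dvdE)
  have "pderiv f = q ^ j * (q * pderiv g + g * (smult (real (Suc j)) (pderiv q)))"
    unfolding g pderiv_mult pderiv_power_Suc by (simp add: algebra_simps)
  then show ?thesis by simp
qed

lemma power_dvd_rodrigues_deriv: "[:-1, 0, 1:] ^ i dvd rodrigues_deriv k (k + i)"
proof (induction k arbitrary: i)
  case 0
  show ?case by (simp add: rodrigues_def dvd_smult)
next
  case (Suc k)
  have "[:-1, 0, 1:] ^ Suc i dvd rodrigues_deriv k (Suc k + i)"
    using Suc.IH[of "Suc i"] by (simp only: add_Suc add_Suc_right)
  then show ?case
    using power_dvd_pderiv by simp
qed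

text \<open>
  Both endpoints are zeros of multiplicity \<open>l\<close> of \<open>p\<^sub>l\<close>. This removes the boundary terms of the
  integrations by parts.
\<close>

lemma rodrigues_deriv_at_ends:
  assumes "k < l"
  shows "poly (rodrigues_deriv k l) 1 = 0" "poly (rodrigues_deriv k l) (-1) = 0"
proof -
  obtain i where "l = k + Suc i"
    using assms less_imp_Suc_add by auto
  then have "[:-1, 0, 1:] dvd rodrigues_deriv k l"
    using power_dvd_rodrigues_deriv[of "Suc i" k] by (auto intro: dvd_mult_left)
  then show "poly (rodrigues_deriv k l) 1 = 0" "poly (rodrigues_deriv k l) (-1) = 0"
    by (auto elim!: dvdE)
qed

section \<open>Orthogonality\<close>

text \<open>
  By \<open>x = cos \<theta>\<close> this is \<open>\<integral> q(x) dx\<close> over \<open>[-1, 1]\<close>. The variable \<open>\<theta>\<close> is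
  kept because the densities and test functions of the limit theorem are functions of \<open>\<theta>\<close>.
\<close>

definition zonal_integral :: "real poly \<Rightarrow> real" where
  "zonal_integral q = integral {0..pi} (\<lambda>\<theta>. sin \<theta> * poly q (cos \<theta>))"

lemma integrable_sin_poly_cos: "(\<lambda>\<theta>. sin \<theta> * poly q (cos \<theta>)) integrable_on {0..pi}" for q :: "real poly"
  by (intro integrable_continuous_real continuous_intros)

lemma zonal_integral_0 [simp]: "zonal_integral 0 = 0"
  by (simp add: zonal_integral_def)

lemma zonal_integral_add: "zonal_integral (p + q) = zonal_integral p + zonal_integral q"
  unfolding zonal_integral_def
  by (subst integral_add[symmetric]) (auto simp: integrable_sin_poly_cos algebra_simps)

lemma zonal_integral_smult: "zonal_integral (smult c q) = c * zonal_integral q"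
  unfolding zonal_integral_def
  by (subst integral_mult_right[symmetric]) (auto simp: algebra_simps)

lemma zonal_integral_pderiv: "zonal_integral (pderiv q) = poly q 1 - poly q (-1)"
proof -
  have "((\<lambda>\<theta>. sin \<theta> * poly (pderiv q) (cos \<theta>)) has_integral
        (- poly q (cos pi) - - poly q (cos 0))) {0..pi}"
  proof (rule fundamental_theorem_of_calculus)
    fix \<theta> :: real assume "\<theta> \<in> {0..pi}"
    have "((\<lambda>\<theta>. - poly q (cos \<theta>)) has_real_derivative sin \<theta> * poly (pderiv q) (cos \<theta>)) (at \<theta> within {0..pi})"
      by (auto intro!: derivative_eq_intros DERIV_chain'[OF _ poly_DERIV])
    then show "((\<lambda>\<theta>. - poly q (cos \<theta>)) has_vector_derivative sin \<theta> * poly (pderiv q) (cos \<theta>)) (at \<theta> within {0..pi})"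
      by (simp add: has_real_derivative_iff_has_vector_derivative)
  qed simp
  then show ?thesis
    unfolding zonal_integral_def by (simp add: integral_unique)
qed

text \<open>
  The hypothesis forces \<open>n < l\<close> or \<open>k < l'\<close>, so one of the two factors vanishes at both endpoints and
  no boundary term remains. Hence derivatives can be moved freely between the factors as long as
  the total number of derivatives is \<open>l + l'\<close>.
\<close>

lemma zonal_integral_by_parts:
  assumes "n + k + 1 = l + l'"
  shows "zonal_integral (rodrigues_deriv (n + 1) l * rodrigues_deriv k l') =
       - zonal_integral (rodrigues_deriv n l * rodrigues_deriv (k + 1) l')"
proof -
  have "n < l \<or> k < l'"
    using assms by linarith
  then have "zonal_integral (pderiv (rodrigues_deriv n l * rodrigues_deriv k l')) = 0"
    using rodrigues_deriv_at_ends by (auto simp: zonal_integral_pderiv)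
  then show ?thesis
    by (simp add: pderiv_mult zonal_integral_add mult.commute)
qed

lemma zonal_integral_shift:
  assumes "n + i + k = l + l'"
  shows "zonal_integral (rodrigues_deriv (n + i) l * rodrigues_deriv k l') =
       (-1) ^ i * zonal_integral (rodrigues_deriv n l * rodrigues_deriv (k + i) l')"
  using assms
proof (induction i arbitrary: k)
  case (Suc i)
  then show ?case
    using zonal_integral_by_parts[of "n + i" k l l'] Suc.IH[of "k + 1"] by simp
qed simp

text \<open>
  Moving all \<open>l + l'\<close> derivatives to the factor of smaller degree index annihilates it: its degree is
  twice that index, which is less than \<open>l + l'\<close>.
\<close>

lemma rodrigues_deriv_orthogonal:
  assumes "n + k = l + l'" "l \<noteq> l'"
  shows "zonal_integral (rodrigues_deriv n l * rodrigues_deriv k l') = 0"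
proof (cases "l < l'")
  case True
  then have "rodrigues_deriv (n + k) l = 0"
    using assms by (intro rodrigues_deriv_eq_0) simp
  then show ?thesis
    using zonal_integral_shift[of n k 0 l l'] assms by simp
next
  case False
  then have "rodrigues_deriv (k + n) l' = 0"
    using assms by (intro rodrigues_deriv_eq_0) simp
  then show ?thesis
    using zonal_integral_shift[of 0 n k l l'] assms by simp
qed

text \<open>
  Let \<open>y\<^sub>l\<close> be the Legendre polynomials. Multiplying the recurrence by \<open>y\<^sub>l\<close> or by \<open>y\<^sub>l\<^sub>+\<^sub>1\<close> and using
  orthogonality evaluates \<open>\<integral> x y\<^sub>l y\<^sub>l\<^sub>+\<^sub>1\<close> in two ways, once by the norm of \<open>y\<^sub>l\<close> and once by that of
  \<open>y\<^sub>l\<^sub>+\<^sub>1\<close>. Comparing them shows that \<open>(2l + 1) \<integral> y\<^sub>l\<^sup>2\<close> does not depend on \<open>l\<close>, and at \<open>l = 0\<close> it is \<open>2\<close>.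
\<close>

lemma zonal_integral_legendre_square:
  "zonal_integral (rodrigues_deriv l l * rodrigues_deriv l l) = 2 / (2 * real l + 1)"
proof (induction l)
  case 0
  then show ?case
    using zonal_integral_pderiv[of "[:0, 1:]"] by (simp add: pderiv_pCons one_pCons)
next
  case (Suc l)
  define y where "y i = rodrigues_deriv i i" for i
  have orth: "zonal_integral (y i * y j) = 0" if "i \<noteq> j" for i j
    using rodrigues_deriv_orthogonal[of i j i j] that by (simp add: y_def)
  have rec: "smult (real i + 2) (y (i + 2)) = smult (2 * real i + 3) ([:0, 1:] * y (i + 1)) - smult (real i + 1) (y i)" for i
    using rodrigues_deriv_recurrence[of i "i + 1"] by (simp add: y_def algebra_simps)
  define c where "c = zonal_integral ([:0, 1:] * (y l * y (l + 1)))"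
  have "smult (2 * real l + 3) ([:0, 1:] * (y l * y (l + 1))) = 
      smult (real l + 2) (y (l + 2) * y l) + smult (real l + 1) (y l * y l)"
  proof -
    have "smult (real l + 2) (y (l + 2)) * y l + smult (real l + 1) (y l * y l)
      = smult (2 * real l + 3) ([:0, 1:] * (y l * y (l + 1)))"
      unfolding rec by (rule real_poly_eqI) (simp add: algebra_simps)
    then show ?thesis by simp
  qed
  from arg_cong[OF this, of zonal_integral]
  have c1: "(2 * real l + 3) * c = (real l + 1) * zonal_integral (y l * y l)"
    using orth[of "l + 2" l] unfolding c_def zonal_integral_smult zonal_integral_add by simp
   have c2: "(2 * real l + 1) * c = (real l + 1) * zonal_integral (y (l + 1) * y (l + 1))"
  proof (cases l)
    case 0
    have "y 1 = [:0, 1:] * y 0"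
      using pderiv_rodrigues_Suc[of 0] by (simp add: y_def)
    then have "c = zonal_integral (y 1 * y 1)"
      unfolding c_def 0 by (simp only: mult_ac add_0)
    then show ?thesis
      using 0 by simp
  next
    case (Suc i)
    have "smult (real i + 2) (y (i + 2)) * y (i + 2) + smult (real i + 1) (y i * y (i + 2))
      = smult (2 * real i + 3) ([:0, 1:] * (y (i + 1) * y (i + 2)))"
      unfolding rec by (rule real_poly_eqI) (simp add: algebra_simps)
    then have "smult (2 * real i + 3) ([:0, 1:] * (y (i + 1) * y (i + 2))) =
        smult (real i + 2) (y (i + 2) * y (i + 2)) + smult (real i + 1) (y i * y (i + 2))"
      by simp
    from arg_cong[OF this, of zonal_integral] show ?thesis
      using orth[of i "i + 2"] Suc
      unfolding c_def zonal_integral_smult zonal_integral_add by (simp add: add_ac)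
  qed
  have "(real l + 1) * ((2 * real l + 3) * zonal_integral (y (l + 1) * y (l + 1))) =
        (2 * real l + 1) * ((2 * real l + 3) * c)"
    using c2 by (simp add: mult.left_commute)
  also have "\<dots> = (real l + 1) * ((2 * real l + 1) * zonal_integral (y l * y l))"
    unfolding c1 by (simp add: mult.left_commute)
  finally have "(2 * real l + 3) * zonal_integral (y (l + 1) * y (l + 1)) = (2 * real l + 1) * zonal_integral (y l * y l)"
    by (subst (asm) mult_cancel_left) linarith
  also have "\<dots> = 2"
    using Suc.IH by (simp add: y_def del: times_divide_eq_right) (simp add: field_simps)
  finally show ?case
    by (simp add: y_def field_simps)
qed

section \<open>The square of an associated Legendre function\<close>

text \<open>
  The polynomial part of the associated Legendre function, without the factor
  \<open>(-1)\<^sup>m (1 - x\<^sup>2)\<^bsup>m/2\<^esup>\<close>.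
\<close>

definition legendre_factor :: "int \<Rightarrow> nat \<Rightarrow> real poly" where
  "legendre_factor m l = rodrigues_deriv (nat (int l + m)) l"

lemma higher_deriv_poly: "(deriv ^^ n) (poly p) = poly ((pderiv ^^ n) p)" for p :: "real poly"
proof (induction n)
  case (Suc n)
  then show ?case
    by (auto intro!: DERIV_imp_deriv)
qed simp

lemma assoc_Legendre_eq:
  "assoc_Legendre l m x = (-1) powi m * sqrt (1 - x\<^sup>2) powi m * poly (legendre_factor m l) x"
proof -
  have "(\<lambda>t. (t\<^sup>2 - 1) ^ l) = poly ([:-1, 0, 1 :: real:] ^ l)"
    by (auto simp: power2_eq_square)
  then have "(deriv ^^ nat (int l + m)) (\<lambda>t. (t\<^sup>2 - 1) ^ l) x = poly ((pderiv ^^ nat (int l + m)) ([:-1, 0, 1 :: real:] ^ l)) x"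
    by (simp only: higher_deriv_poly)
  then show ?thesis
    by (simp add: assoc_Legendre_def legendre_factor_def rodrigues_def higher_pderiv_smult)
qed

lemma legendre_factor_reflect:
  assumes "\<mu> \<le> l"
  shows "fact (l + \<mu>) * poly (legendre_factor (- int \<mu>) l) x =
         fact (l - \<mu>) * (x\<^sup>2 - 1) ^ \<mu> * poly (legendre_factor (int \<mu>) l) x"
proof -
  have a: "2 * \<mu> + (l - \<mu>) = l + \<mu>" "\<mu> + (l - \<mu>) = l" "nat (int l - int \<mu>) = l - \<mu>" "nat (int l + int \<mu>) = l + \<mu>"
    using assms by auto
  show ?thesis
    using arg_cong[OF rodrigues_deriv_reflect[of \<mu> "l - \<mu>"], of "\<lambda>p. poly p x"] unfolding a
    by (simp add: legendre_factor_def a power2_eq_square)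
qed

text \<open>
  By the reflection formula, the weight \<open>(1 - x\<^sup>2)\<^sup>m\<close> of the square trades one factor of order \<open>m\<close> for a
  factor of order \<open>-m\<close>, and the constants match the normalisation exactly. The right-hand side is a
  polynomial for either sign of \<open>m\<close>. At \<open>x = \<plusminus>1\<close> the weight degenerates, so these points are excluded.
\<close>

lemma assoc_Legendre_square:
  assumes "\<bar>x\<bar> < 1" "int l \<ge> \<bar>m\<bar>"
  shows "fact (nat (int l - m)) / fact (nat (int l + m)) * (assoc_Legendre l m x)\<^sup>2 =
         (-1) powi m * poly (legendre_factor m l * legendre_factor (- m) l) x"
proof -
  define \<mu> where "\<mu> = nat \<bar>m\<bar>"
  have \<mu>: "\<mu> \<le> l" using assms by (simp add: \<mu>_def)
  define A B where "A = poly (legendre_factor (int \<mu>) l) x" and "B = poly (legendre_factor (- int \<mu>) l) x"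
  define w where "w = 1 - x\<^sup>2"
  have w: "w > 0" using assms by (simp add: w_def abs_square_less_1)
  define s :: real where "s = (-1) ^ \<mu>"
  have s: "s * s = 1" "(-1) powi m = s"
    by (auto simp: s_def \<mu>_def power_int_def simp flip: power_mult_distrib)
  have sq: "((-1) ^ \<mu> * a)\<^sup>2 = a\<^sup>2" for a :: real
    by (simp add: power_mult_distrib flip: power_mult)
  have "(x\<^sup>2 - 1) ^ \<mu> = (-1) ^ \<mu> * w ^ \<mu>"
    by (simp add: w_def flip: power_mult_distrib)
  then have "fact (l + \<mu>) * B = s * (fact (l - \<mu>) * (w ^ \<mu> * A))"
    using legendre_factor_reflect[OF \<mu>, of x] by (simp add: A_def B_def s_def)
  then have B: "B = s * (fact (l - \<mu>) / fact (l + \<mu>) * (w ^ \<mu> * A))"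
    by (simp add: field_simps)
  show ?thesis
  proof (cases "m \<ge> 0")
    case True
    then have m: "m = int \<mu>" by (simp add: \<mu>_def)
    have "(assoc_Legendre l m x)\<^sup>2 = w ^ \<mu> * A\<^sup>2"
      using w by (simp add: assoc_Legendre_eq m sq mult.assoc A_def w_def[symmetric] power_mult_distrib)
         (simp add: power2_eq_square flip: power_mult_distrib)
    moreover have "nat (int l - m) = l - \<mu>" "nat (int l + m) = l + \<mu>"
      using \<mu> by (auto simp: m)
    moreover have "(-1) powi m * poly (legendre_factor m l * legendre_factor (- m) l) x = s * (A * B)"
      by (simp only: s(2) poly_mult) (simp add: m A_def B_def)
    moreover have "s * (A * B) = (s * s) * (fact (l - \<mu>) / fact (l + \<mu>) * (w ^ \<mu> * A\<^sup>2))"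
      unfolding B by (simp add: power2_eq_square)
    ultimately show ?thesis
      by (simp only: s mult_1)
  next
    case False
    then have m: "m = - int \<mu>" by (simp add: \<mu>_def)
    have "(assoc_Legendre l m x)\<^sup>2 = B\<^sup>2 / w ^ \<mu>"
      using w by (simp add: assoc_Legendre_eq m power_int_minus mult.assoc B_def w_def[symmetric] power_mult_distrib)
         (simp add: power2_eq_square field_simps flip: power_mult_distrib)
    moreover have "nat (int l - m) = l + \<mu>" "nat (int l + m) = l - \<mu>"
      using \<mu> by (auto simp: m)
    moreover have "(-1) powi m * poly (legendre_factor m l * legendre_factor (- m) l) x = s * (B * A)"
      by (simp only: s(2) poly_mult) (simp add: m A_def B_def)
    moreover have "s * (B * A) = fact (l + \<mu>) / fact (l - \<mu>) * (B\<^sup>2 / w ^ \<mu>)"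
    proof -
      have "fact (l + \<mu>) / fact (l - \<mu>) * (B\<^sup>2 / w ^ \<mu>) = fact (l + \<mu>) / fact (l - \<mu>) * B / w ^ \<mu> * B"
        by (simp add: power2_eq_square)
      also have "fact (l + \<mu>) / fact (l - \<mu>) * B / w ^ \<mu> = s * A"
        using w by (simp add: B)
      finally show ?thesis by simp
    qed
    ultimately show ?thesis
      by (simp only:)
  qed
qed

section \<open>Limits of the moments\<close>

lemma legendre_factor_recurrence:
  assumes "int l \<ge> \<bar>m\<bar>"
  shows "smult (2 * real l + 3) ([:0, 1:] * legendre_factor m (l + 1)) =
         smult (real l + 2 - of_int m) (legendre_factor m (l + 2))
         + smult (real l + 1 + of_int m) (legendre_factor m l)"
proof -
  define n where "n = nat (int (l + 1) + m)"
  have n: "nat (int (l + 2) + m) = n + 1" "nat (int l + m) = n - 1"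
    and real_n: "real n = real l + 1 + of_int m"
    using assms by (auto simp: n_def)
  have coeff: "2 * real l + 3 - (real l + 1 + of_int m) = real l + 2 - of_int m"
    by simp
  show ?thesis
    using rodrigues_deriv_recurrence[of l n]
    unfolding legendre_factor_def n n_def[symmetric] real_n coeff by (simp only: eq_diff_eq)
qed

text \<open>
  Up to normalisation, the matrix element of multiplication by \<open>x\<^sup>k\<close> between the associated Legendre
  functions of degrees \<open>l + j\<close> and \<open>l\<close>. Only \<open>j = 0\<close> is wanted in the end, but multiplication by
  \<open>x\<close> couples neighbouring degrees, so an induction on \<open>k\<close> needs all shifts \<open>j\<close>. Taking the factors
  with orders \<open>m\<close> and \<open>-m\<close> keeps the integrand polynomial.
\<close>

definition cross_moment :: "int \<Rightarrow> nat \<Rightarrow> int \<Rightarrow> nat \<Rightarrow> real" where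
  "cross_moment m k j l = (-1) powi m * ((2 * real l + 1) / 2) *
     zonal_integral ([:0, 1:] ^ k * (legendre_factor m (nat (int l + j)) * legendre_factor (- m) l))"

lemma cross_moment_0:
  assumes "int l \<ge> \<bar>m\<bar>" "int l + j \<ge> \<bar>m\<bar>"
  shows "cross_moment m 0 j l = (if j = 0 then 1 else 0)"
proof (cases "j = 0")
  case False
  have "zonal_integral (legendre_factor m (nat (int l + j)) * legendre_factor (- m) l) = 0"
    unfolding legendre_factor_def
    by (rule rodrigues_deriv_orthogonal) (use assms False in auto)
  then show ?thesis
    using False by (simp add: cross_moment_def)
next
  case True
  define \<mu> where "\<mu> = nat \<bar>m\<bar>"
  have \<mu>: "\<mu> \<le> l" using assms by (simp add: \<mu>_def)
  have "zonal_integral (rodrigues_deriv (l + \<mu>) l * rodrigues_deriv (l - \<mu>) l) = (-1) ^ \<mu> * (2 / (2 * real l + 1))"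
    using zonal_integral_shift[of l \<mu> "l - \<mu>" l l] zonal_integral_legendre_square[of l] \<mu> by simp
  moreover have "legendre_factor m l * legendre_factor (- m) l = rodrigues_deriv (l + \<mu>) l * rodrigues_deriv (l - \<mu>) l"
  proof (cases "m \<ge> 0")
    case True
    then have "nat (int l + m) = l + \<mu>" "nat (int l + - m) = l - \<mu>"
      by (auto simp: \<mu>_def)
    then show ?thesis
      by (simp only: legendre_factor_def)
  next
    case False
    then have "nat (int l + m) = l - \<mu>" "nat (int l + - m) = l + \<mu>"
      by (auto simp: \<mu>_def)
    then show ?thesis
      by (simp only: legendre_factor_def mult.commute)
  qed
  moreover have "(-1) powi m = ((-1) ^ \<mu> :: real)"
    by (cases "m \<ge> 0") (auto simp: \<mu>_def power_int_def)
  ultimately have "cross_moment m 0 j l =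
      ((-1) ^ \<mu> * (-1) ^ \<mu>) * ((2 * real l + 1) / 2 * (2 / (2 * real l + 1)))"
    using True by (simp add: cross_moment_def del: times_divide_eq_left times_divide_eq_right)
  also have "\<dots> = 1"
    by (simp flip: power_mult_distrib)
  finally show ?thesis
    using True by simp
qed

text \<open>
  The factor \<open>x\<close> is absorbed into the function of degree \<open>l + j\<close> by the three-term recurrence. For
  fixed \<open>j\<close> and \<open>m\<close> both coefficients tend to \<open>1/2\<close> as \<open>l\<close> grows.
\<close>

lemma cross_moment_Suc:
  assumes "int l + j \<ge> \<bar>m\<bar> + 1"
  shows "cross_moment m (Suc k) j l =
      (real l + (of_int j - of_int m + 1)) / (2 * real l + (2 * of_int j + 1)) * cross_moment m k (j + 1) l
    + (real l + (of_int j + of_int m)) / (2 * real l + (2 * of_int j + 1)) * cross_moment m k (j - 1) l"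
proof -
  define i where "i = nat (int l + j - 1)"
  have i: "nat (int l + j) = i + 1" "nat (int l + (j + 1)) = i + 2" "nat (int l + (j - 1)) = i"
      "int i \<ge> \<bar>m\<bar>" and ri: "real i = real l + of_int j - 1"
    using assms by (auto simp: i_def)
  define V where "V p = zonal_integral ([:0, 1:] ^ k * (p * legendre_factor (- m) l))" for p
  have V: "V (smult c p + smult d q) = c * V p + d * V q" for c d p q
    unfolding V_def zonal_integral_smult[symmetric] zonal_integral_add[symmetric]
    by (simp add: algebra_simps)
  have "(2 * real i + 3) * V ([:0, 1:] * legendre_factor m (i + 1)) =
        V (smult (2 * real i + 3) ([:0, 1:] * legendre_factor m (i + 1)) + smult 0 0)"
    unfolding V by simp
  also have "\<dots> = (real i + 2 - of_int m) * V (legendre_factor m (i + 2)) + (real i + 1 + of_int m) * V (legendre_factor m i)"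
    unfolding legendre_factor_recurrence[OF i(4)] by (simp add: V)
  finally have "V ([:0, 1:] * legendre_factor m (i + 1)) =
      ((real i + 2 - of_int m) * V (legendre_factor m (i + 2)) + (real i + 1 + of_int m) * V (legendre_factor m i))
      / (2 * real i + 3)"
    by (subst nonzero_eq_divide_eq) (linarith, simp only: mult.commute)
  then have "V ([:0, 1:] * legendre_factor m (i + 1)) =
       (real i + 2 - of_int m) / (2 * real i + 3) * V (legendre_factor m (i + 2))
     + (real i + 1 + of_int m) / (2 * real i + 3) * V (legendre_factor m i)"
    by (simp only: times_divide_eq_left flip: add_divide_distrib)
  moreover have "real i + 2 - of_int m = real l + (of_int j - of_int m + 1)" "real i + 1 + of_int m = real l + (of_int j + of_int m)"
     "2 * real i + 3 = 2 * real l + (2 * of_int j + 1)"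
    using ri by auto
  moreover have "cross_moment m (Suc k) j l = (-1) powi m * ((2 * real l + 1) / 2) * V ([:0, 1:] * legendre_factor m (i + 1))"
    by (simp only: cross_moment_def V_def i power_Suc mult.assoc mult.left_commute)
  moreover have "cross_moment m k (j + 1) l = (-1) powi m * ((2 * real l + 1) / 2) * V (legendre_factor m (i + 2))"
     "cross_moment m k (j - 1) l = (-1) powi m * ((2 * real l + 1) / 2) * V (legendre_factor m i)"
    by (simp_all only: cross_moment_def V_def i)
  ultimately show ?thesis
    by (simp only:) (simp only: algebra_simps)
qed

lemma integral_cos_int: "integral {0..pi} (\<lambda>\<theta>. cos (of_int j * \<theta>)) = (if j = 0 then pi else 0)"
proof (cases "j = 0")
  case False
  have "((\<lambda>\<theta>. cos (of_int j * \<theta>)) has_integral (sin (of_int j * pi) / of_int j - sin (of_int j * 0) / of_int j)) {0..pi}"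
    by (rule fundamental_theorem_of_calculus)
       (use False in \<open>auto intro!: derivative_eq_intros simp: has_real_derivative_iff_has_vector_derivative[symmetric]\<close>)
  then show ?thesis
    using False by (simp add: integral_unique sin_integer_2pi sin_times_pi_eq_0)
qed simp

text \<open>
  In the limit the recurrence becomes that of \<open>\<integral> cos(j\<theta>) cos\<^sup>k \<theta> d\<theta>\<close>, because
  \<open>cos \<theta> cos(j\<theta>) = (cos((j+1)\<theta>) + cos((j-1)\<theta>)) / 2\<close>; for \<open>k = 0\<close> both families are the Kronecker delta
  \<open>\<delta>\<^sub>j\<^sub>0\<close>, by orthogonality.
\<close>

lemma cross_moment_tendsto:
  "cross_moment m k j \<longlonglongrightarrow> 1 / pi * integral {0..pi} (\<lambda>\<theta>. cos (of_int j * \<theta>) * cos \<theta> ^ k)"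
proof (induction k arbitrary: j)
  case 0
  have "\<forall>\<^sub>F l in sequentially. l \<ge> nat (\<bar>m\<bar> + \<bar>j\<bar>)"
    by (rule eventually_ge_at_top)
  then have "\<forall>\<^sub>F l in sequentially. 1 / pi * integral {0..pi} (\<lambda>\<theta>. cos (of_int j * \<theta>) * cos \<theta> ^ 0) = cross_moment m 0 j l"
    by eventually_elim (auto simp: cross_moment_0 integral_cos_int)
  then show ?case
    by (rule Lim_transform_eventually[OF tendsto_const])
next
  case (Suc k)
  define I where "I i = integral {0..pi} (\<lambda>\<theta>. cos (of_int i * \<theta>) * cos \<theta> ^ k)" for i
  have "integral {0..pi} (\<lambda>\<theta>. cos (of_int j * \<theta>) * cos \<theta> ^ Suc k) =
        integral {0..pi} (\<lambda>\<theta>. 1/2 * (cos (of_int (j + 1) * \<theta>) * cos \<theta> ^ k) + 1/2 * (cos (of_int (j - 1) * \<theta>) * cos \<theta> ^ k))"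
    by (intro integral_cong) (simp add: distrib_right left_diff_distrib cos_add cos_diff algebra_simps)
  also have "\<dots> = 1/2 * I (j + 1) + 1/2 * I (j - 1)"
    unfolding I_def integral_mult_right[symmetric]
    by (intro integral_add integrable_continuous_real continuous_intros)
  finally have I: "integral {0..pi} (\<lambda>\<theta>. cos (of_int j * \<theta>) * cos \<theta> ^ Suc k) = 1/2 * I (j + 1) + 1/2 * I (j - 1)" .
  have lim: "(\<lambda>l. (real l + c) / (2 * real l + d)) \<longlonglongrightarrow> 1/2" for c d
  proof -
    have "(\<lambda>l. (1 + c / real l) / (2 + d / real l)) \<longlonglongrightarrow> (1 + 0) / (2 + 0)"
      by (intro tendsto_intros lim_const_over_n) simp
    moreover have "\<forall>\<^sub>F l in sequentially. (1 + c / real l) / (2 + d / real l) = (real l + c) / (2 * real l + d)"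
      using eventually_gt_at_top[of 0]
    proof eventually_elim
      case (elim l)
      then have "(1 + c / real l) / (2 + d / real l) = ((real l + c) / real l) / ((2 * real l + d) / real l)"
        by (simp add: add_divide_distrib)
      then show ?case using elim by simp
    qed
    ultimately show ?thesis
      using Lim_transform_eventually by force
  qed
  have "(\<lambda>l. (real l + (of_int j - of_int m + 1)) / (2 * real l + (2 * of_int j + 1)) * cross_moment m k (j + 1) l
           + (real l + (of_int j + of_int m)) / (2 * real l + (2 * of_int j + 1)) * cross_moment m k (j - 1) l)
        \<longlonglongrightarrow> 1/2 * (1 / pi * I (j + 1)) + 1/2 * (1 / pi * I (j - 1))"
    unfolding I_def by (intro tendsto_intros lim Suc.IH)
  moreover have "\<forall>\<^sub>F l in sequentially.
      (real l + (of_int j - of_int m + 1)) / (2 * real l + (2 * of_int j + 1)) * cross_moment m k (j + 1) l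
           + (real l + (of_int j + of_int m)) / (2 * real l + (2 * of_int j + 1)) * cross_moment m k (j - 1) l
      = cross_moment m (Suc k) j l"
    using eventually_ge_at_top[of "nat (\<bar>m\<bar> + \<bar>j\<bar> + 1)"]
    by eventually_elim (subst cross_moment_Suc; auto)
  ultimately have "cross_moment m (Suc k) j \<longlonglongrightarrow> 1/2 * (1 / pi * I (j + 1)) + 1/2 * (1 / pi * I (j - 1))"
    by (rule Lim_transform_eventually)
  then show ?case
    unfolding I by (simp add: algebra_simps)
qed

section \<open>From moments to continuous functions\<close>

text \<open>
  The method of moments. Since the cosine is injective on \<open>[0, \<pi>]\<close>, the Weierstrass theorem for
  \<open>g \<circ> arccos\<close> approximates \<open>g\<close> uniformly by polynomials in \<open>cos \<theta>\<close>. Nonnegativity and the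
  convergence of the total mass (the case \<open>k = 0\<close>) bound the error uniformly in \<open>l\<close>.
\<close>

lemma weak_convergence_from_cos_moments:
  fixes d :: "nat \<Rightarrow> real \<Rightarrow> real" and g :: "real \<Rightarrow> real"
  assumes cont: "\<And>l. continuous_on {0..pi} (d l)"
    and nonneg: "\<forall>\<^sub>F l in sequentially. \<forall>\<theta>\<in>{0..pi}. d l \<theta> \<ge> 0"
    and moments: "\<And>k. (\<lambda>l. integral {0..pi} (\<lambda>\<theta>. cos \<theta> ^ k * d l \<theta>)) \<longlonglongrightarrow> 1 / pi * integral {0..pi} (\<lambda>\<theta>. cos \<theta> ^ k)"
    and g: "continuous_on {0..pi} g"
  shows "(\<lambda>l. integral {0..pi} (\<lambda>\<theta>. g \<theta> * d l \<theta>)) \<longlonglongrightarrow> 1 / pi * integral {0..pi} g"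
proof (rule tendstoI)
  fix e :: real assume e: "e > 0"
  (* Budget: 2 \<epsilon> and \<epsilon> for the two replacements of g by p, and less than \<epsilon> for the limit of p. *)
  define \<epsilon> where "\<epsilon> = e / 4"
  have \<epsilon>: "\<epsilon> > 0" using e by (simp add: \<epsilon>_def)
  have "continuous_on {-1..1} (\<lambda>x. g (arccos x))"
    by (rule continuous_on_compose2[OF g]) (auto intro!: continuous_intros arccos_lbound arccos_ubound)
  then obtain p where "real_polynomial_function p" and p: "\<And>x. x \<in> {-1..1} \<Longrightarrow> \<bar>g (arccos x) - p x\<bar> < \<epsilon>"
    using Stone_Weierstrass_real_polynomial_function[of "{-1..1::real}" "\<lambda>x. g (arccos x)" \<epsilon>] \<epsilon> by auto
  then obtain c n where p_eq: "p = (\<lambda>x. \<Sum>i\<le>n. c i * x ^ i)"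
    by (auto simp: real_polynomial_function_iff_sum)
  have approx: "\<bar>g \<theta> - p (cos \<theta>)\<bar> \<le> \<epsilon>" if "\<theta> \<in> {0..pi}" for \<theta>
    using p[of "cos \<theta>"] that by (simp add: arccos_cos)
  have p_cont: "continuous_on {0..pi} (\<lambda>\<theta>. p (cos \<theta>))"
    unfolding p_eq by (intro continuous_intros)
  have int_p: "integral {0..pi} (\<lambda>\<theta>. p (cos \<theta>) * f \<theta>) = (\<Sum>i\<le>n. c i * integral {0..pi} (\<lambda>\<theta>. cos \<theta> ^ i * f \<theta>))"
    if "continuous_on {0..pi} f" for f
    unfolding p_eq sum_distrib_right integral_mult_right[symmetric]
    by (subst integral_sum) (auto intro!: integrable_continuous_real continuous_intros that simp: mult.assoc)
  have lim_p: "(\<lambda>l. integral {0..pi} (\<lambda>\<theta>. p (cos \<theta>) * d l \<theta>)) \<longlonglongrightarrow> 1 / pi * integral {0..pi} (\<lambda>\<theta>. p (cos \<theta>))"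
  proof -
    have "(\<lambda>l. \<Sum>i\<le>n. c i * integral {0..pi} (\<lambda>\<theta>. cos \<theta> ^ i * d l \<theta>)) \<longlonglongrightarrow>
        (\<Sum>i\<le>n. c i * (1 / pi * integral {0..pi} (\<lambda>\<theta>. cos \<theta> ^ i)))"
      by (intro tendsto_intros moments)
    then show ?thesis
      using int_p[of "\<lambda>_. 1"] by (simp add: int_p cont sum_divide_distrib)
  qed
  have lim_1: "(\<lambda>l. integral {0..pi} (d l)) \<longlonglongrightarrow> 1"
    using moments[of 0] by simp
  have error: "\<bar>integral {0..pi} (\<lambda>\<theta>. g \<theta> * f \<theta>) - integral {0..pi} (\<lambda>\<theta>. p (cos \<theta>) * f \<theta>)\<bar> \<le> \<epsilon> * integral {0..pi} f"
    if f: "continuous_on {0..pi} f" "\<And>\<theta>. \<theta> \<in> {0..pi} \<Longrightarrow> f \<theta> \<ge> 0" for f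
  proof -
    have "integral {0..pi} (\<lambda>\<theta>. g \<theta> * f \<theta>) - integral {0..pi} (\<lambda>\<theta>. p (cos \<theta>) * f \<theta>) =
        integral {0..pi} (\<lambda>\<theta>. g \<theta> * f \<theta> - p (cos \<theta>) * f \<theta>)"
      by (intro integral_diff[symmetric] integrable_continuous_real continuous_intros g f p_cont)
    also have "norm \<dots> \<le> integral {0..pi} (\<lambda>\<theta>. \<epsilon> * f \<theta>)"
    proof (rule integral_norm_bound_integral)
      fix \<theta> :: real assume \<theta>: "\<theta> \<in> {0..pi}"
      have "\<bar>g \<theta> - p (cos \<theta>)\<bar> * f \<theta> \<le> \<epsilon> * f \<theta>"
        using \<theta> approx f(2) by (intro mult_right_mono) auto
      then show "norm (g \<theta> * f \<theta> - p (cos \<theta>) * f \<theta>) \<le> \<epsilon> * f \<theta>"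
        using f(2)[OF \<theta>] by (simp add: abs_mult flip: left_diff_distrib)
    qed (intro integrable_continuous_real continuous_intros g f p_cont)+
    finally show ?thesis by simp
  qed
  have triangle: "\<bar>G - G'\<bar> < 4 * \<epsilon>"
    if "\<bar>G - P\<bar> \<le> 2 * \<epsilon>" "\<bar>G' - P'\<bar> \<le> \<epsilon>" "\<bar>P - P'\<bar> < \<epsilon>" for G P G' P' :: real
    using that by linarith
  have "\<forall>\<^sub>F l in sequentially. integral {0..pi} (d l) < 2"
    using lim_1 by (rule order_tendstoD) simp
  moreover have "\<forall>\<^sub>F l in sequentially. dist (integral {0..pi} (\<lambda>\<theta>. p (cos \<theta>) * d l \<theta>)) (1 / pi * integral {0..pi} (\<lambda>\<theta>. p (cos \<theta>))) < \<epsilon>"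
    using lim_p \<epsilon> by (rule tendstoD)
  ultimately show "\<forall>\<^sub>F l in sequentially. dist (integral {0..pi} (\<lambda>\<theta>. g \<theta> * d l \<theta>)) (1 / pi * integral {0..pi} g) < e"
    using nonneg
  proof eventually_elim
    case (elim l)
    have "\<epsilon> * integral {0..pi} (d l) \<le> \<epsilon> * 2"
      using elim \<epsilon> by (intro mult_left_mono) auto
    then have "\<bar>integral {0..pi} (\<lambda>\<theta>. g \<theta> * d l \<theta>) - integral {0..pi} (\<lambda>\<theta>. p (cos \<theta>) * d l \<theta>)\<bar> \<le> 2 * \<epsilon>"
      using error[of "d l"] elim cont by auto
    (* The limit is itself a density of total mass 1, so the same error bound applies to it. *)
    moreover have "\<bar>1 / pi * integral {0..pi} g - 1 / pi * integral {0..pi} (\<lambda>\<theta>. p (cos \<theta>))\<bar> \<le> \<epsilon>"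
      using error[of "\<lambda>_. 1 / pi"] by simp
    ultimately have "\<bar>integral {0..pi} (\<lambda>\<theta>. g \<theta> * d l \<theta>) - 1 / pi * integral {0..pi} g\<bar> < 4 * \<epsilon>"
      using elim(2) unfolding dist_real_def by (rule triangle)
    then show ?case
      by (simp add: dist_real_def \<epsilon>_def)
  qed
qed

section \<open>Convergence of the densities\<close>

definition legendre_density :: "int \<Rightarrow> nat \<Rightarrow> real \<Rightarrow> real" where
  "legendre_density m l \<theta> = (-1) powi m * ((2 * real l + 1) / 2) *
     (sin \<theta> * poly (legendre_factor m l * legendre_factor (- m) l) (cos \<theta>))"

text \<open>
  At the endpoints, which the formula for the square excludes, both sides contain \<open>sin \<theta> = 0\<close>.
  The right-hand side is visibly nonnegative, the left-hand side visibly continuous.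
\<close>

lemma legendre_density_eq:
  assumes "int l \<ge> \<bar>m\<bar>" "\<theta> \<in> {0..pi}"
  shows "legendre_density m l \<theta> =
    (2 * real l + 1) / 2 * (fact (nat (int l - m)) / fact (nat (int l + m))) *
    (sin \<theta> * \<bar>assoc_Legendre l m (cos \<theta>)\<bar>\<^sup>2)"
proof (cases "sin \<theta> = 0")
  case False
  then have "(cos \<theta>)\<^sup>2 < 1"
    by (simp add: cos_squared_eq)
  then have "\<bar>cos \<theta>\<bar> < 1"
    by (simp add: abs_square_less_1)
  note square = assoc_Legendre_square[OF this assms(1)]
  have "legendre_density m l \<theta> = (2 * real l + 1) / 2 * (sin \<theta> *
      ((-1) powi m * poly (legendre_factor m l * legendre_factor (- m) l) (cos \<theta>)))"
    unfolding legendre_density_def by (simp only: mult_ac)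
  then show ?thesis
    unfolding square[symmetric] power2_abs by (simp only: mult_ac)
qed (simp add: legendre_density_def)

lemma continuous_on_legendre_density: "continuous_on S (legendre_density m l)"
  unfolding legendre_density_def by (intro continuous_intros)

lemma legendre_density_moment:
  "integral {0..pi} (\<lambda>\<theta>. cos \<theta> ^ k * legendre_density m l \<theta>) = cross_moment m k 0 l"
  unfolding cross_moment_def zonal_integral_def integral_mult_right[symmetric] legendre_density_def
  by (intro integral_cong) (simp add: poly_power)

lemma legendre_density_tendsto:
  assumes "continuous_on {0..pi} g"
  shows "(\<lambda>l. integral {0..pi} (\<lambda>\<theta>. g \<theta> * legendre_density m l \<theta>)) \<longlonglongrightarrow> 1 / pi * integral {0..pi} g"
proof (rule weak_convergence_from_cos_moments[OF _ _ _ assms])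
  show "\<forall>\<^sub>F l in sequentially. \<forall>\<theta>\<in>{0..pi}. legendre_density m l \<theta> \<ge> 0"
    using eventually_ge_at_top[of "nat \<bar>m\<bar>"]
    by eventually_elim (auto simp: legendre_density_eq sin_ge_zero)
  show "(\<lambda>l. integral {0..pi} (\<lambda>\<theta>. cos \<theta> ^ k * legendre_density m l \<theta>)) \<longlonglongrightarrow> 1 / pi * integral {0..pi} (\<lambda>\<theta>. cos \<theta> ^ k)" for k
    using cross_moment_tendsto[of m k 0] by (simp add: legendre_density_moment)
qed (rule continuous_on_legendre_density)

theorem proposition6p4:
  fixes m :: int and a :: "real \<Rightarrow> complex"
  assumes "continuous_on {0..pi} a"
  shows "((\<lambda>l::nat.
            complex_of_real ((2 * real l + 1) / 2 *
              (fact (nat (int l - m)) / fact (nat (int l + m)))) *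
            integral {0..pi} (\<lambda>\<theta>. a \<theta> *
              complex_of_real (sin \<theta> * \<bar>assoc_Legendre l m (cos \<theta>)\<bar>\<^sup>2)))
          \<longlongrightarrow> complex_of_real (1 / pi) * integral {0..pi} a)
         (inf sequentially (principal {l. int l \<ge> \<bar>m\<bar>}))"
proof -
  have Re_Im: "Re (integral {0..pi} f) = integral {0..pi} (\<lambda>\<theta>. Re (f \<theta>))"
     "Im (integral {0..pi} f) = integral {0..pi} (\<lambda>\<theta>. Im (f \<theta>))"
    if "continuous_on {0..pi} f" for f :: "real \<Rightarrow> complex"
    using integral_linear[OF integrable_continuous_real[OF that] bounded_linear_Re]
      integral_linear[OF integrable_continuous_real[OF that] bounded_linear_Im]
    by (simp_all add: o_def)
  have cont: "continuous_on {0..pi} (\<lambda>\<theta>. a \<theta> * complex_of_real (legendre_density m l \<theta>))" for l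
    by (intro continuous_intros assms continuous_on_legendre_density)
  have "(\<lambda>l. integral {0..pi} (\<lambda>\<theta>. a \<theta> * complex_of_real (legendre_density m l \<theta>)))
     \<longlonglongrightarrow> complex_of_real (1 / pi) * integral {0..pi} a"
    unfolding tendsto_complex_iff Re_Im[OF cont]
    using legendre_density_tendsto[of "\<lambda>\<theta>. Re (a \<theta>)" m] legendre_density_tendsto[of "\<lambda>\<theta>. Im (a \<theta>)" m] assms
    by (simp add: Re_Im continuous_on_Re continuous_on_Im)
  then have "((\<lambda>l. integral {0..pi} (\<lambda>\<theta>. a \<theta> * complex_of_real (legendre_density m l \<theta>)))
     \<longlongrightarrow> complex_of_real (1 / pi) * integral {0..pi} a) (inf sequentially (principal {l. int l \<ge> \<bar>m\<bar>}))"
    by (rule tendsto_mono[OF inf_le1])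
  moreover have "integral {0..pi} (\<lambda>\<theta>. a \<theta> * complex_of_real (legendre_density m l \<theta>)) =
      complex_of_real ((2 * real l + 1) / 2 * (fact (nat (int l - m)) / fact (nat (int l + m)))) *
      integral {0..pi} (\<lambda>\<theta>. a \<theta> * complex_of_real (sin \<theta> * \<bar>assoc_Legendre l m (cos \<theta>)\<bar>\<^sup>2))"
    if "int l \<ge> \<bar>m\<bar>" for l
    unfolding integral_mult_right[symmetric]
    by (intro integral_cong) (simp only: legendre_density_eq[OF that] of_real_mult mult_ac)
  then have "\<forall>\<^sub>F l in inf sequentially (principal {l. int l \<ge> \<bar>m\<bar>}).
      integral {0..pi} (\<lambda>\<theta>. a \<theta> * complex_of_real (legendre_density m l \<theta>)) =
      complex_of_real ((2 * real l + 1) / 2 * (fact (nat (int l - m)) / fact (nat (int l + m)))) *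
      integral {0..pi} (\<lambda>\<theta>. a \<theta> * complex_of_real (sin \<theta> * \<bar>assoc_Legendre l m (cos \<theta>)\<bar>\<^sup>2))"
    by (auto simp: eventually_inf_principal)
  ultimately show ?thesis
    by (rule Lim_transform_eventually)
qed

end
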